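(* Let $f:\mathbb{N}^\star\to[0,1]$ be an admissible function. Then $\mathrm{NSD}_f$, defined for non-empty finite strings $x$ and $y$ by $$\mathrm{NSD}_f(x,y)=\max\{S_f(x|^{+}y),\,S_f(y|^{+}x)\},$$ is a normalized semi-distance on non-empty finite strings. That is, for all non-empty finite strings $x$ (over an alphabet $\mathcal{A}_x$) and $y$ (over an alphabet $\mathcal{A}_y$): (normalization) $0\le \mathrm{NSD}_f(x,y)\le 1$; (symmetry) $\mathrm{NSD}_f(x,y)=\mathrm{NSD}_f(y,x)$; (non-negativity) $\mathrm{NSD}_f(x,y)\ge 0$; (identity of indiscernibles) $\mathrm{NSD}_f(x,y)=0$ if and only if $x=y$.
   Context: Strings are finite sequences of letters (literals) from finite alphabets; $|x|$ is the length of the string $x$, and $\mathbb{N}^\star$ is the set of non-zero natural numbers. Admissible function: a function $f:\mathbb{N}^\star\to[0,1]$ that is monotonically increasing (in the non-strict sense, i.e. non-decreasing). Factorization of $x$ given $y$ in Ziv-Merhav mode (written $x|^{+}y$): the reference string is all of $y$. The string $x$ is parsed greedily from left to right. At the current position of $x$, let $\ell$ be the length of the longest prefix of the remaining part of $x$ that occurs as a contiguous substring of $y$. If $\ell>1$, a symbol (reference) of length $l=\ell$ is produced and the position advances by $\ell$; otherwise a symbol (literal) of length $l=1$ is produced and the position advances by $1$. This continues until $x$ is exhausted. Let $\mathcal{L}=\mathcal{L}_{x|^{+}y}$ be the finite collection, counted with multiplicity, of the lengths $l\geq 1$ of all symbols produced (references and literals), and let $|\mathcal{L}|$ be the number of symbols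 produced. In particular, all lengths are at least $1$ and they sum to $|x|$; if $x=y$ then exactly one symbol, of length $|x|$, is produced. For such a collection, $|\mathcal{L}|_f=\sum_{l\in\mathcal{L}}f(l)$ (with multiplicity). Conditional complexity estimate: $$S_f(x|^{+}y)=\left(1-\frac{\sum_{l\in\mathcal{L}}l f(l)-(|\mathcal{L}|_f-1)}{|x|}\right)\cdot\frac{|\mathcal{L}|-1}{|x|},\qquad \mathcal{L}=\mathcal{L}_{x|^{+}y}.$$ $S_f(y|^{+}x)$ is defined in the same way with the roles of $x$ and $y$ exchanged (the function $f$ being the same). A semi-distance is a function satisfying symmetry, non-negativity and identity of indiscernibles (the triangle inequality is not required); it is normalized if it takes values in $[0,1]$.
   Formalization: "NSD_f(x,y)=0 implies x=y" is claimed only when x and y are not both of length one, since two distinct one-letter strings are each parsed as one literal and have NSD_f=0; all other clauses, including that x=y gives NSD_f=0, hold for all non-empty strings. *)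

theory Defs
  imports Complex_Main "HOL-Library.Sublist" "HOL-Library.Multiset"
begin

text \<open>Only the values of \<open>f\<close> at nonzero arguments are constrained or used.\<close>

definition admissible :: "(nat \<Rightarrow> real) \<Rightarrow> bool" where
  "admissible f \<longleftrightarrow> (\<forall>n\<ge>1. 0 \<le> f n \<and> f n \<le> 1) \<and> mono_on {1..} f"

text \<open>Length of the longest prefix of \<open>u\<close> that occurs contiguously in \<open>y\<close>.\<close>

definition longest_match :: "'a list \<Rightarrow> 'a list \<Rightarrow> nat" where
  "longest_match u y = Max {l. l \<le> length u \<and> sublist (take l u) y}"

definition symbol_length :: "'a list \<Rightarrow> 'a list \<Rightarrow> nat" where
  "symbol_length u y = (if longest_match u y > 1 then longest_match u y else 1)"

text \<open>Symbol lengths in the order in which the greedy Ziv--Merhav parsing of the first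
  argument, with the whole second argument as reference, produces them.\<close>

function zm_lengths :: "'a list \<Rightarrow> 'a list \<Rightarrow> nat list" where
  "zm_lengths x y =
     (if x = [] then []
      else symbol_length x y # zm_lengths (drop (symbol_length x y) x) y)"
  by pat_completeness auto
termination
  by (relation "measure (\<lambda>(x, y). length x)") (auto simp: symbol_length_def)

declare zm_lengths.simps [simp del]

definition zm_multiset :: "'a list \<Rightarrow> 'a list \<Rightarrow> nat multiset" where
  "zm_multiset x y = mset (zm_lengths x y)"

text \<open>\<open>S f x y\<close> is the estimate for \<open>x\<close> given \<open>y\<close>.\<close>

definition S :: "(nat \<Rightarrow> real) \<Rightarrow> 'a list \<Rightarrow> 'a list \<Rightarrow> real" where
  "S f x y =
     (let L = zm_multiset x y; n = real (length x) in
       (1 - ((\<Sum>l\<in>#L. real l * f l) - ((\<Sum>l\<in>#L. f l) - 1)) / n)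
       * ((real (size L) - 1) / n))"

definition NSD :: "(nat \<Rightarrow> real) \<Rightarrow> 'a list \<Rightarrow> 'a list \<Rightarrow> real" where
  "NSD f x y = max (S f x y) (S f y x)"

text \<open>A one-letter string is always parsed as a single literal, whatever the reference is, so
  any two one-letter strings are at distance zero, even if they differ.  Identity of
  indiscernibles therefore cannot hold for a pair of one-letter strings.\<close>

lemma NSD_one_letter: "NSD f [a] [b] = 0"
proof -
  have "symbol_length [c] [d] = 1" for c d :: 'a
  proof -
    have "longest_match [c] [d] \<in> {l. l \<le> length [c] \<and> sublist (take l [c]) [d]}"
      unfolding longest_match_def
    proof (rule Max_in)
      show "finite {l. l \<le> length [c] \<and> sublist (take l [c]) [d]}"
        by (rule finite_subset[of _ "{..length [c]}"]) auto
      have "0 \<in> {l. l \<le> length [c] \<and> sublist (take l [c]) [d]}" by simp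
      then show "{l. l \<le> length [c] \<and> sublist (take l [c]) [d]} \<noteq> {}" by blast
    qed
    then show ?thesis by (simp add: symbol_length_def)
  qed
  then have "zm_lengths [c] [d] = [1]" for c d :: 'a
    by (simp add: zm_lengths.simps)
  then show ?thesis by (simp add: NSD_def S_def zm_multiset_def)
qed

end

(* Since f <= 1 and the symbol lengths l >= 1 sum to n = |x|, a parse into k symbols has
   sum (l - 1) f(l) <= n - k.  Hence the first factor of S is at least (k - 1) / n, and
   ((k - 1) / n)^2 <= S <= 1.  So S vanishes exactly when x is parsed as a single symbol, that
   is, when x is one letter or a substring of y; mutual substrings are equal. *)
theory Submission
  imports Defs
begin

text \<open>The empty prefix always matches, so \<open>Max\<close> ranges over a nonempty finite set
  and is attained.\<close>

lemma longest_match_in: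
  "longest_match u y \<in> {l. l \<le> length u \<and> sublist (take l u) y}"
  unfolding longest_match_def
proof (rule Max_in)
  have "0 \<in> {l. l \<le> length u \<and> sublist (take l u) y}" by simp
  then show "{l. l \<le> length u \<and> sublist (take l u) y} \<noteq> {}" by blast
qed simp

lemma longest_match_le: "longest_match u y \<le> length u"
  using longest_match_in[of u y] by simp

lemma longest_match_eq_length_iff: "longest_match u y = length u \<longleftrightarrow> sublist u y"
proof
  assume "longest_match u y = length u"
  then show "sublist u y"
    using longest_match_in[of u y] by simp
next
  assume "sublist u y"
  then have "length u \<le> longest_match u y"
    unfolding longest_match_def by (intro Max_ge) auto
  then show "longest_match u y = length u"
    using longest_match_le[of u y] by simp
qed

lemma symbol_length_ge_1: "1 \<le> symbol_length u y"
  by (simp add: symbol_length_def)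

lemma symbol_length_le: "u \<noteq> [] \<Longrightarrow> symbol_length u y \<le> length u"
  using longest_match_le[of u y] by (simp add: symbol_length_def Suc_le_eq)

text \<open>The first disjunct comes from literals: a lone remaining letter is consumed whether or
  not it occurs in \<open>y\<close>.\<close>

lemma symbol_length_eq_length_iff:
  assumes "u \<noteq> []"
  shows "symbol_length u y = length u \<longleftrightarrow> length u = 1 \<or> sublist u y"
  using assms longest_match_le[of u y] longest_match_eq_length_iff[of u y]
  by (cases u) (auto simp: symbol_length_def)

lemma zm_lengths_Nil_iff: "zm_lengths x y = [] \<longleftrightarrow> x = []"
  by (subst zm_lengths.simps) simp

lemma zm_lengths_ge_1: "l \<in> set (zm_lengths x y) \<Longrightarrow> 1 \<le> l"
proof (induction x y rule: zm_lengths.induct)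
  case (1 x y)
  then show ?case
    using symbol_length_ge_1[of x y]
    by (subst (asm) (2) zm_lengths.simps) (auto split: if_splits)
qed

lemma sum_list_zm_lengths: "sum_list (zm_lengths x y) = length x"
proof (induction x y rule: zm_lengths.induct)
  case (1 x y)
  then show ?case
    using symbol_length_le[of x y] by (subst zm_lengths.simps) auto
qed

text \<open>There is just one symbol exactly when the first one leaves no remainder.\<close>

lemma length_zm_lengths_eq_1_iff:
  assumes "x \<noteq> []"
  shows "length (zm_lengths x y) = 1 \<longleftrightarrow> length x = 1 \<or> sublist x y"
proof -
  have "length (zm_lengths x y) = 1 \<longleftrightarrow> length x \<le> symbol_length x y"
    using assms by (subst zm_lengths.simps) (simp add: zm_lengths_Nil_iff)
  then show ?thesis
    using symbol_length_le[OF assms, of y] symbol_length_eq_length_iff[OF assms, of y] by auto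
qed

text \<open>Merging the two sums gives terms \<open>(l - 1) * f l\<close>, each between 0 and
  \<open>l - 1\<close>. Up to the constant 1, \<open>w\<close> is the numerator in the first factor
  of \<open>S\<close>.\<close>

lemma sum_list_weighted_bounds:
  assumes "\<And>l. l \<in> set ls \<Longrightarrow> 1 \<le> l \<and> 0 \<le> f l \<and> f l \<le> (1::real)"
  defines "w \<equiv> (\<Sum>l\<leftarrow>ls. real l * f l) - (\<Sum>l\<leftarrow>ls. f l)"
  shows "0 \<le> w" and "w \<le> real (sum_list ls) - real (length ls)"
proof -
  have w: "w = (\<Sum>l\<leftarrow>ls. (real l - 1) * f l)"
    unfolding w_def by (simp add: sum_list_subtractf[symmetric] left_diff_distrib)
  show "0 \<le> w"
    unfolding w using assms(1) by (intro sum_list_nonneg) auto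
  have "w \<le> (\<Sum>l\<leftarrow>ls. real l - 1)"
    unfolding w using assms(1) by (intro sum_list_mono) (auto intro!: mult_left_le)
  also have "\<dots> = real (sum_list ls) - real (length ls)"
    by (induction ls) auto
  finally show "w \<le> real (sum_list ls) - real (length ls)" .
qed

text \<open>The lower bound is a square so that it gives both nonnegativity of \<open>S\<close> and,
  when \<open>S\<close> vanishes, a parse into one symbol.\<close>

lemma S_bounds:
  assumes "admissible f" and "x \<noteq> []"
  shows "((real (length (zm_lengths x y)) - 1) / real (length x))\<^sup>2 \<le> S f x y"
    and "S f x y \<le> 1"
    and "length (zm_lengths x y) = 1 \<Longrightarrow> S f x y = 0"
proof -
  define ls where "ls = zm_lengths x y"
  define n where "n = real (length x)"
  define k where "k = real (length ls)"
  define w where "w = (\<Sum>l\<leftarrow>ls. real l * f l) - (\<Sum>l\<leftarrow>ls. f l)"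
  have S: "S f x y = (1 - (w + 1) / n) * ((k - 1) / n)"
    by (simp add: S_def zm_multiset_def w_def n_def k_def ls_def Let_def sum_mset_sum_list
        algebra_simps flip: mset_map)
  have n: "0 < n"
    using assms(2) by (simp add: n_def)
  have k: "1 \<le> k"
    using assms(2) by (simp add: k_def ls_def zm_lengths_Nil_iff Suc_le_eq)
  have w: "0 \<le> w" "w \<le> n - k"
    using sum_list_weighted_bounds[of ls f] assms(1) zm_lengths_ge_1[of _ x y]
    by (auto simp: w_def n_def k_def ls_def sum_list_zm_lengths admissible_def)
  have q: "0 \<le> (k - 1) / n" "(k - 1) / n \<le> 1"
    using n k w by (auto simp: field_simps)
  have p: "(k - 1) / n \<le> 1 - (w + 1) / n" "1 - (w + 1) / n \<le> 1"
  proof -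
    have "1 - (w + 1) / n = (n - (w + 1)) / n"
      using n by (simp add: diff_divide_distrib)
    \<comment> \<open>From \<open>w \<le> n - k\<close> follows
      \<open>k - 1 \<le> n - (w + 1)\<close>.\<close>
    then show "(k - 1) / n \<le> 1 - (w + 1) / n"
      using n w by (simp add: divide_right_mono)
    show "1 - (w + 1) / n \<le> 1"
      using n w by simp
  qed
  show "((real (length (zm_lengths x y)) - 1) / real (length x))\<^sup>2 \<le> S f x y"
    using mult_right_mono[OF p(1) q(1)]
    by (simp add: S power2_eq_square k_def n_def ls_def)
  show "S f x y \<le> 1"
    unfolding S using p q by (intro mult_le_one) auto
  show "S f x y = 0" if "length (zm_lengths x y) = 1"
    unfolding S using that by (simp add: k_def ls_def)
qed

lemma S_nonneg:
  assumes "admissible f" and "x \<noteq> []"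
  shows "0 \<le> S f x y"
  using S_bounds(1)[OF assms, of y] by (rule order_trans[rotated]) simp

lemma S_eq_0_iff:
  assumes "admissible f" and "x \<noteq> []"
  shows "S f x y = 0 \<longleftrightarrow> length x = 1 \<or> sublist x y"
proof -
  \<comment> \<open>A square bounded above by 0 has base 0, and its denominator
    \<open>length x\<close> is nonzero.\<close>
  have "length (zm_lengths x y) = 1" if "S f x y = 0"
    using S_bounds(1)[OF assms, of y] that assms(2) by simp
  then show ?thesis
    using S_bounds(3)[OF assms, of y] length_zm_lengths_eq_1_iff[OF assms(2), of y] by blast
qed

text \<open>A maximum of nonnegative values vanishes only if both do. If \<open>x\<close> is one
  letter and \<open>y\<close> is a substring of \<open>x\<close>, then \<open>y\<close>, being
  nonempty, is one letter too; so a mixed case adds nothing new.\<close>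

lemma NSD_eq_0_iff:
  assumes "admissible f" and "x \<noteq> []" and "y \<noteq> []"
  shows "NSD f x y = 0 \<longleftrightarrow> length x = 1 \<and> length y = 1 \<or> x = y"
proof -
  have "NSD f x y = 0 \<longleftrightarrow> S f x y = 0 \<and> S f y x = 0"
    using S_nonneg[OF assms(1,2), of y] S_nonneg[OF assms(1,3), of x]
    by (auto simp: NSD_def max_def)
  also have "\<dots> \<longleftrightarrow> (length x = 1 \<or> sublist x y) \<and> (length y = 1 \<or> sublist y x)"
    using S_eq_0_iff[OF assms(1,2)] S_eq_0_iff[OF assms(1,3)] by simp
  also have "\<dots> \<longleftrightarrow> length x = 1 \<and> length y = 1 \<or> x = y"
  proof -
    \<comment> \<open>The parts of \<open>y\<close> before and after the occurrence of
      \<open>x\<close> must be empty.\<close>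
    have "x = y" if "sublist x y" "length y \<le> length x" for x y :: "'a list"
      using that by (auto simp: sublist_def)
    moreover have "1 \<le> length x" "1 \<le> length y"
      using assms(2,3) by (simp_all add: Suc_le_eq)
    ultimately show ?thesis
      by (cases "length y \<le> length x") (auto dest: sublist_length_le)
  qed
  finally show ?thesis .
qed

text \<open>Both alphabets lie in one type \<open>'a\<close>, so that \<open>x = y\<close> makes
  sense. The converse half of the identity of indiscernibles excludes pairs of one-letter strings,
  where \<open>NSD_one_letter\<close> gives distance 0 even for distinct letters.\<close>

theorem mainTheorem1:
  fixes f :: "nat \<Rightarrow> real" and Ax Ay :: "'a set" and x y :: "'a list"
  assumes "admissible f"
    and "finite Ax" and "finite Ay"
    and "x \<in> lists Ax" and "y \<in> lists Ay"
    and "x \<noteq> []" and "y \<noteq> []"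
  shows "(0 \<le> NSD f x y \<and> NSD f x y \<le> 1)
    \<and> NSD f x y = NSD f y x
    \<and> NSD f x y \<ge> 0
    \<and> (x = y \<longrightarrow> NSD f x y = 0)
    \<and> (\<not> (length x = 1 \<and> length y = 1) \<longrightarrow> (NSD f x y = 0 \<longleftrightarrow> x = y))"
proof -
  have "0 \<le> NSD f x y" "NSD f x y \<le> 1"
    using S_nonneg[of f x y] S_bounds(2)[of f x y] S_bounds(2)[of f y x] assms
    by (auto simp: NSD_def max_def)
  moreover have "NSD f x y = NSD f y x"
    by (simp add: NSD_def max.commute)
  ultimately show ?thesis
    using NSD_eq_0_iff[of f x y] assms by auto
qed

end
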